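(* Let $\mu=\mu_{\mathbb{B}}\wedge\mu_{\mathcal{LA}(\mathbb{Q})}\wedge\mu_{\mathcal{T}}$ be a truth assignment satisfying some ground $\mathcal{LA}(\mathbb{Q})\cup\mathcal{T}$-formula, where $\mu_{\mathbb{B}}$ is a consistent conjunction of Boolean literals and $\mu_{\mathcal{LA}(\mathbb{Q})}$, $\mu_{\mathcal{T}}$ are conjunctions of $\mathcal{LA}(\mathbb{Q})$-pure and $\mathcal{T}$-pure literals respectively, and let $\mathcal{EX}_{ed}(\mu)$ be the complete set of $ed$-extensions of $\mu$. Then (a) $\mathit{mincost}(\mu)=\min_{\eta\in\mathcal{EX}_{ed}(\mu)}\mathit{mincost}(\eta)$; (b) for every $\eta=\mu\wedge\mu_{ed}\in\mathcal{EX}_{ed}(\mu)$: $\mathit{mincost}(\eta)=+\infty$ if $\mu_{\mathcal{T}}\wedge\mu_{ed}$ is $\mathcal{T}$-unsatisfiable or $\mu_{\mathcal{LA}(\mathbb{Q})}\wedge\mu_{ed}$ is $\mathcal{LA}(\mathbb{Q})$-unsatisfiable, and $\mathit{mincost}(\eta)=\mathit{mincost}(\mu_{\mathcal{LA}(\mathbb{Q})}\wedge\mu_{ed})$ otherwise.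
   Context: $\mathcal{T}$ is a stably-infinite first-order theory with equality whose signature is disjoint from that of linear arithmetic over the rationals $\mathcal{LA}(\mathbb{Q})$ (interpreted in its standard model over $\mathbb{Q}$); $\mathit{cost}$ is an $\mathcal{LA}(\mathbb{Q})$-variable. A literal is $\mathcal{LA}(\mathbb{Q})$-pure (resp. $\mathcal{T}$-pure) if it contains only variables and symbols of the signature of $\mathcal{LA}(\mathbb{Q})$ (resp. $\mathcal{T}$). Interface variables of $\mu$ are the variables occurring both in $\mathcal{LA}(\mathbb{Q})$-pure and in $\mathcal{T}$-pure atoms of $\mu$; fixing a total order $\prec$ on them, the interface equalities are $IE(\mu)=\{(x_i=x_j)\mid x_i\prec x_j\}$. For each equivalence relation $Eq$ on the interface variables, let $\mu_e=\bigwedge_{(x_i=x_j)\in IE(\mu),\,(x_i,x_j)\in Eq}(x_i=x_j)$, $\mu_d=\bigwedge_{(x_i=x_j)\in IE(\mu),\,(x_i,x_j)\notin Eq}\neg(x_i=x_j)$ and $\mu_{ed}=\mu_e\wedge\mu_d$. The complete set of $ed$-extensions $\mathcal{EX}_{ed}(\mu)$ is the set of all assignments $\mu\wedge\mu_{ed}$ obtained in this way, for every such $Eq$. For a conjunction of literals $\psi$, $\mathit{mincost}(\psi)$ is the minimal (infimal) value of $\mathit{cost}$ over the models of $\psi$ (in $\mathcal{LA}(\mathbb{Q})\cup\mathcal{T}$, resp. $\mathcal{LA}(\mathbb{Q})$ for pure $\mathcal{LA}(\mathbb{Q})$ conjunctions), $+\infty$ if $\psi$ is unsatisfiable and $-\infty$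 if $\mathit{cost}$ is unbounded below.
   Formalization: The signature of T is assumed countable: a theory of uncountably many pairwise distinct constants is stably infinite but has no model over Q, so (b) fails. T-satisfiability and stable infiniteness use models inside any fixed infinite set, equivalent by Löwenheim–Skolem. *)

theory Defs
  imports
    Complex_Main
    "HOL-Library.Extended_Real"
    "HOL-Library.Countable_Set"
    "HOL-Library.Infinite_Typeclass"
begin

section \<open>First-order syntax\<close>

datatype 'f trm = Var nat | Fn 'f "'f trm list"

text \<open>\<open>Prop b\<close> is a Boolean atom. Equality is a logical symbol and belongs to no signature.\<close>

datatype ('f, 'p) atom =
    Prop nat
  | Equal "'f trm" "'f trm"
  | Rel 'p "'f trm list"

datatype (atoms: 'a) fm = Atom 'a | Neg "'a fm" | Conj "'a fm" "'a fm" | Forall nat "'a fm"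

datatype 'a literal = Pos (atom_of: 'a) | Not (atom_of: 'a)

fun trm_vars :: "'f trm \<Rightarrow> nat set" where
  "trm_vars (Var x) = {x}"
| "trm_vars (Fn f ts) = (\<Union>t\<in>set ts. trm_vars t)"

fun atom_vars :: "('f, 'p) atom \<Rightarrow> nat set" where
  "atom_vars (Prop b) = {}"
| "atom_vars (Equal s t) = trm_vars s \<union> trm_vars t"
| "atom_vars (Rel p ts) = (\<Union>t\<in>set ts. trm_vars t)"

fun free_vars :: "('f, 'p) atom fm \<Rightarrow> nat set" where
  "free_vars (Atom a) = atom_vars a"
| "free_vars (Neg F) = free_vars F"
| "free_vars (Conj F G) = free_vars F \<union> free_vars G"
| "free_vars (Forall x F) = free_vars F - {x}"

text \<open>
  A signature is a set of function symbols and a set of predicate symbols, each with its arity.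
\<close>

type_synonym ('f, 'p) signature = "('f \<times> nat) set \<times> ('p \<times> nat) set"

fun trm_over :: "('f, 'p) signature \<Rightarrow> 'f trm \<Rightarrow> bool" where
  "trm_over Sig (Var x) \<longleftrightarrow> True"
| "trm_over Sig (Fn f ts) \<longleftrightarrow> (f, length ts) \<in> fst Sig \<and> (\<forall>t\<in>set ts. trm_over Sig t)"

text \<open>
  Boolean atoms are over no signature. An equality between two variables is over every signature,
  hence pure for both theories.
\<close>

fun atom_over :: "('f, 'p) signature \<Rightarrow> ('f, 'p) atom \<Rightarrow> bool" where
  "atom_over Sig (Prop b) \<longleftrightarrow> False"
| "atom_over Sig (Equal s t) \<longleftrightarrow> trm_over Sig s \<and> trm_over Sig t"
| "atom_over Sig (Rel p ts) \<longleftrightarrow> (p, length ts) \<in> snd Sig \<and> (\<forall>t\<in>set ts. trm_over Sig t)"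

definition pure :: "('f, 'p) signature \<Rightarrow> ('f, 'p) atom literal \<Rightarrow> bool" where
  "pure Sig l \<longleftrightarrow> atom_over Sig (atom_of l)"

definition boolean_literal :: "('f, 'p) atom literal \<Rightarrow> bool" where
  "boolean_literal l \<longleftrightarrow> (\<exists>b. atom_of l = Prop b)"

text \<open>Ground formulas in the sense of SMT: quantifier-free, possibly with free variables.\<close>

fun quantifier_free :: "'a fm \<Rightarrow> bool" where
  "quantifier_free (Atom a) \<longleftrightarrow> True"
| "quantifier_free (Neg F) \<longleftrightarrow> quantifier_free F"
| "quantifier_free (Conj F G) \<longleftrightarrow> quantifier_free F \<and> quantifier_free G"
| "quantifier_free (Forall x F) \<longleftrightarrow> False"

definition sentence_over :: "('f, 'p) signature \<Rightarrow> ('f, 'p) atom fm \<Rightarrow> bool" where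
  "sentence_over Sig F \<longleftrightarrow> (\<forall>a\<in>atoms F. atom_over Sig a) \<and> free_vars F = {}"


section \<open>First-order semantics\<close>

record ('f, 'p, 'd) interp =
  universe :: "'d set"
  fun_int :: "'f \<Rightarrow> 'd list \<Rightarrow> 'd"
  rel_int :: "'p \<Rightarrow> 'd list \<Rightarrow> bool"
  prop_int :: "nat \<Rightarrow> bool"

text \<open>
  An interpretation is a structure for a signature as soon as it behaves well on the symbols of
  that signature. Symbols outside it are interpreted too, but arbitrarily; this way formulas of the
  component languages and of the combined language share one semantics.
\<close>

definition is_structure :: "('f, 'p) signature \<Rightarrow> ('f, 'p, 'd) interp \<Rightarrow> bool" where
  "is_structure Sig M \<longleftrightarrow> universe M \<noteq> {} \<and>
     (\<forall>(f, n) \<in> fst Sig. \<forall>ds. length ds = n \<longrightarrow> set ds \<subseteq> universe M \<longrightarrow> fun_int M f ds \<in> universe M)"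

definition assignment :: "('f, 'p, 'd) interp \<Rightarrow> (nat \<Rightarrow> 'd) \<Rightarrow> bool" where
  "assignment M v \<longleftrightarrow> range v \<subseteq> universe M"

fun trm_val :: "('f, 'p, 'd) interp \<Rightarrow> (nat \<Rightarrow> 'd) \<Rightarrow> 'f trm \<Rightarrow> 'd" where
  "trm_val M v (Var x) = v x"
| "trm_val M v (Fn f ts) = fun_int M f (map (trm_val M v) ts)"

fun atom_holds :: "('f, 'p, 'd) interp \<Rightarrow> (nat \<Rightarrow> 'd) \<Rightarrow> ('f, 'p) atom \<Rightarrow> bool" where
  "atom_holds M v (Prop b) \<longleftrightarrow> prop_int M b"
| "atom_holds M v (Equal s t) \<longleftrightarrow> trm_val M v s = trm_val M v t"
| "atom_holds M v (Rel p ts) \<longleftrightarrow> rel_int M p (map (trm_val M v) ts)"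

fun fm_holds :: "('f, 'p, 'd) interp \<Rightarrow> (nat \<Rightarrow> 'd) \<Rightarrow> ('f, 'p) atom fm \<Rightarrow> bool" where
  "fm_holds M v (Atom a) \<longleftrightarrow> atom_holds M v a"
| "fm_holds M v (Neg F) \<longleftrightarrow> \<not> fm_holds M v F"
| "fm_holds M v (Conj F G) \<longleftrightarrow> fm_holds M v F \<and> fm_holds M v G"
| "fm_holds M v (Forall x F) \<longleftrightarrow> (\<forall>d\<in>universe M. fm_holds M (v(x := d)) F)"

fun lit_holds :: "('f, 'p, 'd) interp \<Rightarrow> (nat \<Rightarrow> 'd) \<Rightarrow> ('f, 'p) atom literal \<Rightarrow> bool" where
  "lit_holds M v (Pos a) \<longleftrightarrow> atom_holds M v a"
| "lit_holds M v (Not a) \<longleftrightarrow> \<not> atom_holds M v a"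

text \<open>A conjunction of literals is represented by the set of its conjuncts.\<close>

definition conj_holds ::
    "('f, 'p, 'd) interp \<Rightarrow> (nat \<Rightarrow> 'd) \<Rightarrow> ('f, 'p) atom literal set \<Rightarrow> bool" where
  "conj_holds M v \<psi> \<longleftrightarrow> (\<forall>l\<in>\<psi>. lit_holds M v l)"

definition theory_models ::
    "('f, 'p) signature \<Rightarrow> ('f, 'p) atom fm set \<Rightarrow> ('f, 'p, 'd) interp set" where
  "theory_models Sig T =
     {M. is_structure Sig M \<and> (\<forall>F\<in>T. \<forall>v. assignment M v \<longrightarrow> fm_holds M v F)}"

definition satisfiable_in ::
    "('f, 'p, 'd) interp set \<Rightarrow> ('f, 'p) atom literal set \<Rightarrow> bool" where
  "satisfiable_in K \<psi> \<longleftrightarrow> (\<exists>M\<in>K. \<exists>v. assignment M v \<and> conj_holds M v \<psi>)"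

text \<open>
  HOL cannot quantify over all domains inside a formula, so satisfiability in a theory refers to
  structures whose universe is a nonempty subset of a given type \<open>'u\<close>. For a countable signature
  and infinite \<open>'u\<close>, the Loewenheim-Skolem theorem makes the choice of \<open>'u\<close> immaterial, both for
  satisfiability and for being stably infinite.
\<close>

definition theory_satisfiable ::
    "'u itself \<Rightarrow> ('f, 'p) signature \<Rightarrow> ('f, 'p) atom fm set \<Rightarrow> ('f, 'p) atom literal set \<Rightarrow> bool" where
  "theory_satisfiable U Sig T \<psi> \<longleftrightarrow>
     satisfiable_in (theory_models Sig T :: ('f, 'p, 'u) interp set) \<psi>"

definition stably_infinite ::
    "'u itself \<Rightarrow> ('f, 'p) signature \<Rightarrow> ('f, 'p) atom fm set \<Rightarrow> bool" where
  "stably_infinite U Sig T \<longleftrightarrow>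
     (\<forall>F. quantifier_free F \<longrightarrow> (\<forall>a\<in>atoms F. atom_over Sig a) \<longrightarrow>
        (\<exists>(M :: ('f, 'p, 'u) interp) \<in> theory_models Sig T.
            \<exists>v. assignment M v \<and> fm_holds M v F) \<longrightarrow>
        (\<exists>(M :: ('f, 'p, 'u) interp) \<in> theory_models Sig T.
            infinite (universe M) \<and> (\<exists>v. assignment M v \<and> fm_holds M v F)))"


section \<open>Linear arithmetic over the rationals\<close>

datatype 'f fun_sym = FSym 'f | Plus | Scale rat | Const rat

datatype 'p pred_sym = PSym 'p | Leq | Less

definition LA_sig :: "('f fun_sym, 'p pred_sym) signature" where
  "LA_sig = ({(Plus, 2)} \<union> {(Scale q, 1) |q. True} \<union> {(Const q, 0) |q. True},
             {(Leq, 2), (Less, 2)})"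

definition LA_models :: "('f fun_sym, 'p pred_sym, rat) interp set" where
  "LA_models = {M. universe M = UNIV \<and>
     (\<forall>a b. fun_int M Plus [a, b] = a + b) \<and>
     (\<forall>q a. fun_int M (Scale q) [a] = q * a) \<and>
     (\<forall>q. fun_int M (Const q) [] = q) \<and>
     (\<forall>a b. rel_int M Leq [a, b] \<longleftrightarrow> a \<le> b) \<and>
     (\<forall>a b. rel_int M Less [a, b] \<longleftrightarrow> a < b)}"

text \<open>
  First-order theories are taken over countable signatures. This is essential for combining with the
  standard model over the countable set of rationals: a theory of uncountably many distinct
  constants is stably infinite but has no model of that cardinality.
\<close>

definition countable_sig :: "('f, 'p) signature \<Rightarrow> bool" where
  "countable_sig Sig \<longleftrightarrow> countable (fst Sig) \<and> countable (snd Sig)"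

definition disjoint_sigs :: "('f, 'p) signature \<Rightarrow> ('f, 'p) signature \<Rightarrow> bool" where
  "disjoint_sigs Sig1 Sig2 \<longleftrightarrow> fst Sig1 \<inter> fst Sig2 = {} \<and> snd Sig1 \<inter> snd Sig2 = {}"

definition sig_union :: "('f, 'p) signature \<Rightarrow> ('f, 'p) signature \<Rightarrow> ('f, 'p) signature" where
  "sig_union Sig1 Sig2 = (fst Sig1 \<union> fst Sig2, snd Sig1 \<union> snd Sig2)"

text \<open>
  Models of the combination: the arithmetic reduct is the standard model and the reduct to the
  other signature is a model of \<open>T\<close>.
\<close>

definition combined_models ::
    "('f fun_sym, 'p pred_sym) signature \<Rightarrow> ('f fun_sym, 'p pred_sym) atom fm set
      \<Rightarrow> ('f fun_sym, 'p pred_sym, rat) interp set" where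
  "combined_models Sig T = LA_models \<inter> theory_models Sig T"

definition combined_ground_formula ::
    "('f fun_sym, 'p pred_sym) signature \<Rightarrow> ('f fun_sym, 'p pred_sym) atom fm \<Rightarrow> bool" where
  "combined_ground_formula Sig F \<longleftrightarrow> quantifier_free F \<and>
     (\<forall>a\<in>atoms F. (\<exists>b. a = Prop b) \<or> atom_over (sig_union LA_sig Sig) a)"

text \<open>
  The infimum in the extended reals is \<open>\<infinity>\<close> if there is no model and \<open>-\<infinity>\<close> if the cost is
  unbounded below.
\<close>

definition mincost ::
    "('f, 'p, rat) interp set \<Rightarrow> nat \<Rightarrow> ('f, 'p) atom literal set \<Rightarrow> ereal" where
  "mincost K cost \<psi> =
     Inf {ereal (real_of_rat (v cost)) |M v. M \<in> K \<and> assignment M v \<and> conj_holds M v \<psi>}"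


section \<open>Truth assignments\<close>

definition consistent :: "'a literal set \<Rightarrow> bool" where
  "consistent \<mu> \<longleftrightarrow> (\<forall>a. \<not> (Pos a \<in> \<mu> \<and> Not a \<in> \<mu>))"

fun prop_lit :: "('a \<Rightarrow> bool) \<Rightarrow> 'a literal \<Rightarrow> bool" where
  "prop_lit \<tau> (Pos a) \<longleftrightarrow> \<tau> a"
| "prop_lit \<tau> (Not a) \<longleftrightarrow> \<not> \<tau> a"

text \<open>
  Boolean abstraction: every atom is treated as a propositional variable. The clause for
  \<open>Forall\<close> is never reached, since only quantifier-free formulas are abstracted.
\<close>

fun prop_fm :: "('a \<Rightarrow> bool) \<Rightarrow> 'a fm \<Rightarrow> bool" where
  "prop_fm \<tau> (Atom a) \<longleftrightarrow> \<tau> a"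
| "prop_fm \<tau> (Neg F) \<longleftrightarrow> \<not> prop_fm \<tau> F"
| "prop_fm \<tau> (Conj F G) \<longleftrightarrow> prop_fm \<tau> F \<and> prop_fm \<tau> G"
| "prop_fm \<tau> (Forall x F) \<longleftrightarrow> undefined"

text \<open>A truth assignment may be partial: it need not assign all atoms of the formula.\<close>

definition truth_assignment :: "'a fm \<Rightarrow> 'a literal set \<Rightarrow> bool" where
  "truth_assignment F \<mu> \<longleftrightarrow> consistent \<mu> \<and> atom_of ` \<mu> \<subseteq> atoms F"

definition prop_satisfies :: "'a literal set \<Rightarrow> 'a fm \<Rightarrow> bool" where
  "prop_satisfies \<mu> F \<longleftrightarrow> (\<forall>\<tau>. (\<forall>l\<in>\<mu>. prop_lit \<tau> l) \<longrightarrow> prop_fm \<tau> F)"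


section \<open>Interface variables and ed-extensions\<close>

definition pure_vars :: "('f, 'p) signature \<Rightarrow> ('f, 'p) atom literal set \<Rightarrow> nat set" where
  "pure_vars Sig \<mu> = (\<Union>l\<in>{l\<in>\<mu>. pure Sig l}. atom_vars (atom_of l))"

definition interface_vars ::
    "('f fun_sym, 'p pred_sym) signature \<Rightarrow> ('f fun_sym, 'p pred_sym) atom literal set \<Rightarrow> nat set" where
  "interface_vars Sig \<mu> = pure_vars LA_sig \<mu> \<inter> pure_vars Sig \<mu>"

text \<open>
  The variable \<open>x\<close> is an arithmetic variable of \<open>\<mu>\<close>: it does not occur in the atoms of the other
  theory only.
\<close>

definition LA_variable ::
    "('f fun_sym, 'p pred_sym) signature \<Rightarrow> ('f fun_sym, 'p pred_sym) atom literal set \<Rightarrow> nat \<Rightarrow> bool" where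
  "LA_variable Sig \<mu> x \<longleftrightarrow> (x \<in> pure_vars Sig \<mu> \<longrightarrow> x \<in> pure_vars LA_sig \<mu>)"

text \<open>
  In what follows \<open>V\<close> is the set of interface variables, \<open>prec\<close> the fixed strict total order on it,
  and an interface equality is represented by the pair of its two variables.
\<close>

definition interface_equalities :: "nat set \<Rightarrow> (nat \<times> nat) set \<Rightarrow> (nat \<times> nat) set" where
  "interface_equalities V prec = {(x, y). x \<in> V \<and> y \<in> V \<and> (x, y) \<in> prec}"

definition mu_e ::
    "nat set \<Rightarrow> (nat \<times> nat) set \<Rightarrow> (nat \<times> nat) set \<Rightarrow> ('f, 'p) atom literal set" where
  "mu_e V prec R =
     {Pos (Equal (Var x) (Var y)) |x y. (x, y) \<in> interface_equalities V prec \<and> (x, y) \<in> R}"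

definition mu_d ::
    "nat set \<Rightarrow> (nat \<times> nat) set \<Rightarrow> (nat \<times> nat) set \<Rightarrow> ('f, 'p) atom literal set" where
  "mu_d V prec R =
     {Not (Equal (Var x) (Var y)) |x y. (x, y) \<in> interface_equalities V prec \<and> (x, y) \<notin> R}"

definition mu_ed ::
    "nat set \<Rightarrow> (nat \<times> nat) set \<Rightarrow> (nat \<times> nat) set \<Rightarrow> ('f, 'p) atom literal set" where
  "mu_ed V prec R = mu_e V prec R \<union> mu_d V prec R"

definition EX_ed ::
    "('f fun_sym, 'p pred_sym) signature \<Rightarrow> (nat \<times> nat) set
      \<Rightarrow> ('f fun_sym, 'p pred_sym) atom literal set
      \<Rightarrow> ('f fun_sym, 'p pred_sym) atom literal set set" where
  "EX_ed Sig prec \<mu> =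
     {\<mu> \<union> mu_ed (interface_vars Sig \<mu>) prec R |R. equiv (interface_vars Sig \<mu>) R}"

end

theory Submission
  imports Defs
begin

text \<open>
  Every model of \<open>\<mu>\<close> induces an equivalence relation on the interface variables and so satisfies
  the corresponding ed-extension, which gives (a). For (b) we amalgamate, as in the correctness
  proof of the Nelson-Oppen procedure. Given an arithmetic model and a model of \<open>T\<close> that induce
  the same relation, make the latter infinite by stable infiniteness and countable by the downward
  Loewenheim-Skolem theorem. Mapping the value of each interface variable to its rational value is
  then a finite injection; it extends to a bijection onto \<open>\<rat>\<close>, along which the
  interpretation of \<open>Sig\<close> is transported. The arithmetic values, hence the cost, do not change.
\<close>

section \<open>Coincidence and isomorphism\<close>

lemma trm_val_cong: "(\<And>x. x \<in> trm_vars t \<Longrightarrow> v x = w x) \<Longrightarrow> trm_val M v t = trm_val M w t"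
proof (induction t)
  case (Fn f ts)
  then have "map (trm_val M v) ts = map (trm_val M w) ts" by auto
  then show ?case by (simp only: trm_val.simps)
qed simp

lemma atom_holds_cong:
  assumes "\<And>x. x \<in> atom_vars a \<Longrightarrow> v x = w x"
  shows "atom_holds M v a = atom_holds M w a"
proof (cases a)
  case (Equal s t)
  then show ?thesis using assms trm_val_cong[of s v w M] trm_val_cong[of t v w M] by auto
next
  case (Rel p ts)
  then have "map (trm_val M v) ts = map (trm_val M w) ts"
    using assms by (auto intro!: trm_val_cong)
  then show ?thesis using Rel by (simp only: atom_holds.simps)
qed simp

lemma lit_holds_cong:
  "(\<And>x. x \<in> atom_vars (atom_of l) \<Longrightarrow> v x = w x) \<Longrightarrow> lit_holds M v l = lit_holds M w l"
  using atom_holds_cong[of "atom_of l" v w M] by (cases l) auto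

lemma fm_holds_cong:
  "(\<And>x. x \<in> free_vars F \<Longrightarrow> v x = w x) \<Longrightarrow> fm_holds M v F = fm_holds M w F"
proof (induction F arbitrary: v w)
  case (Atom a)
  then show ?case using atom_holds_cong[of a v w M] by simp
next
  case (Neg F)
  show ?case using Neg.IH[of v w] Neg.prems by simp
next
  case (Conj F G)
  show ?case using Conj.IH(1)[of v w] Conj.IH(2)[of v w] Conj.prems by simp
next
  case (Forall x F)
  have "fm_holds M (v(x := d)) F = fm_holds M (w(x := d)) F" for d
    by (rule Forall.IH) (use Forall.prems in auto)
  then show ?case by simp
qed

text \<open>Only symbols of \<open>Sig\<close> at their declared arities are constrained, and
  \<open>prop_int\<close> not at all. With \<open>h = id\<close> the notion therefore says that two
  interpretations have the same reduct to \<open>Sig\<close>.\<close>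

definition isomorphism ::
    "('f, 'p) signature \<Rightarrow> ('d \<Rightarrow> 'e) \<Rightarrow> ('f, 'p, 'd) interp \<Rightarrow> ('f, 'p, 'e) interp \<Rightarrow> bool" where
  "isomorphism Sig h M N \<longleftrightarrow> inj_on h (universe M) \<and> universe N = h ` universe M \<and>
     (\<forall>f ds. (f, length ds) \<in> fst Sig \<longrightarrow> set ds \<subseteq> universe M \<longrightarrow>
        fun_int N f (map h ds) = h (fun_int M f ds)) \<and>
     (\<forall>p ds. (p, length ds) \<in> snd Sig \<longrightarrow> set ds \<subseteq> universe M \<longrightarrow>
        rel_int N p (map h ds) = rel_int M p ds)"

lemma isomorphism_fun:
  "isomorphism Sig h M N \<Longrightarrow> (f, length ds) \<in> fst Sig \<Longrightarrow> set ds \<subseteq> universe M \<Longrightarrow>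
     fun_int N f (map h ds) = h (fun_int M f ds)"
  by (simp add: isomorphism_def)

lemma isomorphism_rel:
  "isomorphism Sig h M N \<Longrightarrow> (p, length ds) \<in> snd Sig \<Longrightarrow> set ds \<subseteq> universe M \<Longrightarrow>
     rel_int N p (map h ds) = rel_int M p ds"
  by (simp add: isomorphism_def)

lemma is_structureD:
  "is_structure Sig M \<Longrightarrow> (f, length ds) \<in> fst Sig \<Longrightarrow> set ds \<subseteq> universe M \<Longrightarrow>
     fun_int M f ds \<in> universe M"
  by (auto simp: is_structure_def)

lemma trm_val_in_universe:
  assumes "is_structure Sig M" "assignment M v"
  shows "trm_over Sig t \<Longrightarrow> trm_val M v t \<in> universe M"
proof (induction t)
  case (Var x)
  then show ?case using assms by (auto simp: assignment_def)
next
  case (Fn f ts)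
  then have "set (map (trm_val M v) ts) \<subseteq> universe M" by auto
  then show ?case using Fn.prems is_structureD[OF assms(1), of f "map (trm_val M v) ts"] by simp
qed

lemma isomorphism_trm_val:
  assumes "is_structure Sig M" "isomorphism Sig h M N" "assignment M v"
  shows "trm_over Sig t \<Longrightarrow> trm_val N (h \<circ> v) t = h (trm_val M v t)"
proof (induction t)
  case (Fn f ts)
  have "trm_val N (h \<circ> v) t = h (trm_val M v t)" if "t \<in> set ts" for t
    by (rule Fn.IH[OF that]) (use Fn.prems that in simp)
  then have *: "map (trm_val N (h \<circ> v)) ts = map h (map (trm_val M v) ts)"
    unfolding map_map by (intro map_cong) (simp_all del: o_apply add: o_apply[of h "trm_val M v"])
  have "set (map (trm_val M v) ts) \<subseteq> universe M"
    using Fn.prems trm_val_in_universe[OF assms(1,3)] by auto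
  then have "fun_int N f (map h (map (trm_val M v) ts)) = h (fun_int M f (map (trm_val M v) ts))"
    by (intro isomorphism_fun[OF assms(2)]) (use Fn.prems in simp_all)
  with * show ?case by (simp only: trm_val.simps)
qed simp

lemma isomorphism_atom_holds:
  assumes "is_structure Sig M" "isomorphism Sig h M N" "assignment M v" "atom_over Sig a"
  shows "atom_holds N (h \<circ> v) a \<longleftrightarrow> atom_holds M v a"
proof (cases a)
  case (Prop b)
  then show ?thesis using assms(4) by simp
next
  case (Equal s t)
  \<comment> \<open>Injectivity reflects equality atoms: distinct values stay distinct under
    \<open>h\<close>.\<close>
  have "inj_on h (universe M)" using assms(2) by (simp add: isomorphism_def)
  then show ?thesis
    using Equal assms(4) isomorphism_trm_val[OF assms(1-3)] trm_val_in_universe[OF assms(1,3)]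
    by (auto dest: inj_onD)
next
  case (Rel p ts)
  have *: "map (trm_val N (h \<circ> v)) ts = map h (map (trm_val M v) ts)"
    using Rel assms(4) isomorphism_trm_val[OF assms(1-3)] by auto
  have "set (map (trm_val M v) ts) \<subseteq> universe M"
    using Rel assms(4) trm_val_in_universe[OF assms(1,3)] by auto
  then have "rel_int N p (map h (map (trm_val M v) ts)) = rel_int M p (map (trm_val M v) ts)"
    by (intro isomorphism_rel[OF assms(2)]) (use Rel assms(4) in simp_all)
  with * show ?thesis unfolding Rel by (simp only: atom_holds.simps)
qed

lemma isomorphism_lit_holds:
  assumes "is_structure Sig M" "isomorphism Sig h M N" "assignment M v" "pure Sig l"
  shows "lit_holds N (h \<circ> v) l \<longleftrightarrow> lit_holds M v l"
  using isomorphism_atom_holds[OF assms(1-3), of "atom_of l"] assms(4)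
  by (cases l) (auto simp: pure_def)

lemma isomorphism_fm_holds:
  assumes "is_structure Sig M" "isomorphism Sig h M N"
  shows "assignment M v \<Longrightarrow> \<forall>a\<in>atoms F. atom_over Sig a \<Longrightarrow>
    fm_holds N (h \<circ> v) F \<longleftrightarrow> fm_holds M v F"
proof (induction F arbitrary: v)
  case (Atom a)
  then have "atom_holds N (h \<circ> v) a \<longleftrightarrow> atom_holds M v a"
    by (intro isomorphism_atom_holds[OF assms]) simp_all
  then show ?case by (simp only: fm_holds.simps)
next
  case (Forall x F)
  have U: "universe N = h ` universe M" using assms(2) by (simp add: isomorphism_def)
  have "fm_holds N ((h \<circ> v)(x := h d)) F \<longleftrightarrow> fm_holds M (v(x := d)) F"
    if "d \<in> universe M" for d
  proof -
    have "assignment M (v(x := d))" using Forall.prems that by (auto simp: assignment_def)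
    then have "fm_holds N (h \<circ> v(x := d)) F \<longleftrightarrow> fm_holds M (v(x := d)) F"
      by (rule Forall.IH) (use Forall.prems in simp)
    then show ?thesis by (simp only: fun_upd_comp)
  qed
  then show ?case by (simp add: U del: o_apply)
qed auto

text \<open>Since \<open>h\<close> is onto the universe of \<open>N\<close>, argument lists and
  valuations of \<open>N\<close> have preimages in \<open>M\<close>. Closure under the functions and
  truth of the axioms are thus inherited from \<open>M\<close>.\<close>

lemma isomorphism_theory_models:
  assumes T: "\<forall>F\<in>T. sentence_over Sig F"
    and M: "M \<in> theory_models Sig T" and iso: "isomorphism Sig h M N"
  shows "N \<in> theory_models Sig T"
proof -
  have S: "is_structure Sig M" using M by (simp add: theory_models_def)
  have U: "universe N = h ` universe M" using iso by (simp add: isomorphism_def)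
  have "fun_int N f es \<in> universe N"
    if f: "(f, length es) \<in> fst Sig" and es: "set es \<subseteq> universe N" for f es
  proof -
    define ds where "ds = map (inv_into (universe M) h) es"
    have es': "es = map h ds"
      using es unfolding ds_def U map_map
      by (intro map_idI[symmetric]) (metis comp_apply f_inv_into_f subset_iff)
    have ds: "set ds \<subseteq> universe M"
      using es unfolding ds_def U by (auto intro: inv_into_into)
    have "fun_int N f es = h (fun_int M f ds)"
      using iso f ds unfolding es' isomorphism_def by simp
    then show ?thesis using is_structureD[OF S _ ds, of f] f U es' by simp
  qed
  then have SN: "is_structure Sig N" using S U unfolding is_structure_def by auto
  have "fm_holds N w F" if F: "F \<in> T" and w: "assignment N w" for F w
  proof -
    define v where "v = inv_into (universe M) h \<circ> w"
    have wx: "w x \<in> h ` universe M" for x using w unfolding assignment_def U by auto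
    have "w = h \<circ> v"
      using f_inv_into_f[OF wx] by (simp add: v_def fun_eq_iff)
    have v: "assignment M v"
      using inv_into_into[OF wx] by (auto simp: assignment_def v_def)
    then have "fm_holds M v F" using M F by (simp add: theory_models_def)
    moreover have "\<forall>a\<in>atoms F. atom_over Sig a" using T F by (simp add: sentence_over_def)
    ultimately show ?thesis
      unfolding \<open>w = h \<circ> v\<close> using isomorphism_fm_holds[OF S iso v] by blast
  qed
  with SN show ?thesis by (simp add: theory_models_def)
qed

text \<open>Transport of structure along \<open>h\<close> for the symbols of \<open>Sig\<close>,
  with \<open>inv_into\<close> recovering the original arguments. All other symbols and the Boolean
  atoms keep their meaning from \<open>N\<close>, so that one structure can serve two disjoint
  signatures.\<close>

definition overlay ::
    "('f, 'p) signature \<Rightarrow> ('d \<Rightarrow> 'e) \<Rightarrow> ('f, 'p, 'd) interp \<Rightarrow> ('f, 'p, 'e) interp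
      \<Rightarrow> ('f, 'p, 'e) interp" where
  "overlay Sig h M N = N
     \<lparr>universe := h ` universe M,
      fun_int := (\<lambda>f es. if (f, length es) \<in> fst Sig
        then h (fun_int M f (map (inv_into (universe M) h) es)) else fun_int N f es),
      rel_int := (\<lambda>p es. if (p, length es) \<in> snd Sig
        then rel_int M p (map (inv_into (universe M) h) es) else rel_int N p es)\<rparr>"

lemma isomorphism_overlay:
  assumes "inj_on h (universe M)"
  shows "isomorphism Sig h M (overlay Sig h M N)"
proof -
  have "map (inv_into (universe M) h \<circ> h) ds = ds" if "set ds \<subseteq> universe M" for ds
    using that assms by (intro map_idI) (auto simp: inv_into_f_f subset_iff)
  then show ?thesis using assms by (auto simp: isomorphism_def overlay_def)
qed

lemma LA_models_structure: "M \<in> LA_models \<Longrightarrow> is_structure LA_sig M"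
  by (auto simp: LA_models_def is_structure_def)

text \<open>By disjointness every arithmetic symbol falls into the branch of \<open>overlay\<close>
  that copies \<open>N\<close>, and surjectivity of \<open>h\<close> keeps the universe equal to the
  set of all rationals.\<close>

lemma overlay_LA_models:
  fixes N :: "('f fun_sym, 'p pred_sym, rat) interp"
  assumes "disjoint_sigs Sig LA_sig" "N \<in> LA_models" "h ` universe M = UNIV"
  shows "overlay Sig h M N \<in> LA_models" "isomorphism LA_sig id N (overlay Sig h M N)"
proof -
  let ?K = "overlay Sig h M N" and ?LA = "LA_sig :: ('f fun_sym, 'p pred_sym) signature"
  have f: "fun_int ?K f es = fun_int N f es" if "(f, length es) \<in> fst ?LA" for f es
  proof -
    have "(f, length es) \<notin> fst Sig" using assms(1) that unfolding disjoint_sigs_def by blast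
    then show ?thesis by (simp add: overlay_def)
  qed
  have r: "rel_int ?K p es = rel_int N p es" if "(p, length es) \<in> snd ?LA" for p es
  proof -
    have "(p, length es) \<notin> snd Sig" using assms(1) that unfolding disjoint_sigs_def by blast
    then show ?thesis by (simp add: overlay_def)
  qed
  have U: "universe ?K = UNIV" using assms(3) by (simp add: overlay_def)
  have "fun_int ?K Plus [a, b] = fun_int N Plus [a, b]"
    "fun_int ?K (Scale q) [a] = fun_int N (Scale q) [a]"
    "fun_int ?K (Const q) [] = fun_int N (Const q) []"
    "rel_int ?K Leq [a, b] = rel_int N Leq [a, b]"
    "rel_int ?K Less [a, b] = rel_int N Less [a, b]" for a b q
    by (intro f r; simp add: LA_sig_def)+
  then show "?K \<in> LA_models" using assms(2) U by (simp add: LA_models_def)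
  have "universe N = UNIV" using assms(2) by (simp add: LA_models_def)
  then show "isomorphism LA_sig id N ?K" by (simp add: isomorphism_def U f r)
qed


section \<open>The downward Loewenheim-Skolem theorem\<close>

instance trm :: (countable) countable by countable_datatype
instance fm :: (countable) countable by countable_datatype
instance atom :: (countable, countable) countable by countable_datatype

text \<open>The type of symbols may be uncountable. Renaming the symbols in \<open>A\<close>
  injectively to natural numbers embeds these terms into a countable type. The same renaming works
  for atoms and formulas below.\<close>

lemma countable_trms:
  assumes "countable A"
  shows "countable {t. set_trm t \<subseteq> A}"
proof (rule countableI')
  show "inj_on (to_nat \<circ> map_trm (to_nat_on A)) {t. set_trm t \<subseteq> A}"
  proof (rule inj_onI)
    fix s t assume "s \<in> {t. set_trm t \<subseteq> A}" "t \<in> {t. set_trm t \<subseteq> A}"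
      and "(to_nat \<circ> map_trm (to_nat_on A)) s = (to_nat \<circ> map_trm (to_nat_on A)) t"
    then show "s = t"
      using inj_on_to_nat_on[OF assms]
      by (auto intro!: trm.inj_map_strong[of s t "to_nat_on A" "to_nat_on A"] dest: inj_onD)
  qed
qed

lemma countable_atoms:
  assumes "countable A" "countable B"
  shows "countable {a. set1_atom a \<subseteq> A \<and> set2_atom a \<subseteq> B}" (is "countable ?X")
proof (rule countableI')
  let ?m = "map_atom (to_nat_on A) (to_nat_on B)"
  show "inj_on (to_nat \<circ> ?m) ?X"
  proof (rule inj_onI)
    fix a b assume "a \<in> ?X" "b \<in> ?X" and "(to_nat \<circ> ?m) a = (to_nat \<circ> ?m) b"
    then show "a = b"
      using inj_on_to_nat_on[OF assms(1)] inj_on_to_nat_on[OF assms(2)]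
      by (auto intro!: atom.inj_map_strong[of a b "to_nat_on A" "to_nat_on A" "to_nat_on B" "to_nat_on B"]
          dest: inj_onD)
  qed
qed

lemma countable_fms:
  assumes "countable A"
  shows "countable {F. atoms F \<subseteq> A}"
proof (rule countableI')
  show "inj_on (to_nat \<circ> map_fm (to_nat_on A)) {F. atoms F \<subseteq> A}"
  proof (rule inj_onI)
    fix F G assume "F \<in> {F. atoms F \<subseteq> A}" "G \<in> {F. atoms F \<subseteq> A}"
      and "(to_nat \<circ> map_fm (to_nat_on A)) F = (to_nat \<circ> map_fm (to_nat_on A)) G"
    then show "F = G"
      using inj_on_to_nat_on[OF assms]
      by (auto intro!: fm.inj_map_strong[of F G "to_nat_on A" "to_nat_on A"] dest: inj_onD)
  qed
qed

lemma set_trm_over: "trm_over Sig t \<Longrightarrow> set_trm t \<subseteq> fst ` fst Sig"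
proof (induction t)
  case (Fn f ts)
  have "f \<in> fst ` fst Sig" using Fn.prems by (intro image_eqI[of _ _ "(f, length ts)"]) simp_all
  moreover have "set_trm t \<subseteq> fst ` fst Sig" if "t \<in> set ts" for t
    using Fn that by simp
  ultimately show ?case by auto
qed simp

text \<open>Variables are natural numbers, so it is enough that the names of the symbols in atoms
  over \<open>Sig\<close> come from the countable projections of \<open>Sig\<close>.\<close>

lemma countable_fms_over:
  fixes Sig :: "('f, 'p) signature"
  assumes "countable_sig Sig"
  shows "countable {F :: ('f, 'p) atom fm. \<forall>a\<in>atoms F. atom_over Sig a}"
proof -
  have "set1_atom a \<subseteq> fst ` fst Sig \<and> set2_atom a \<subseteq> fst ` snd Sig"
    if "atom_over Sig a" for a :: "('f, 'p) atom"
    using that by (cases a) (auto dest!: set_trm_over intro: rev_image_eqI)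
  then have "{a :: ('f, 'p) atom. atom_over Sig a} \<subseteq>
      {a. set1_atom a \<subseteq> fst ` fst Sig \<and> set2_atom a \<subseteq> fst ` snd Sig}" by blast
  then have "countable {a :: ('f, 'p) atom. atom_over Sig a}"
    by (rule countable_subset) (use assms in \<open>auto simp: countable_sig_def intro: countable_atoms\<close>)
  from countable_fms[OF this] show ?thesis
    by (rule countable_subset[rotated]) auto
qed

text \<open>The closure consists of the values of the terms built from the operations.\<close>

lemma countable_closure:
  fixes Ops :: "('d list \<Rightarrow> 'd) set"
  assumes "countable Ops" "countable C" "C \<subseteq> U" "C \<noteq> {}"
    and op: "\<And>f ds. f \<in> Ops \<Longrightarrow> set ds \<subseteq> U \<Longrightarrow> f ds \<in> U"
  obtains H where "countable H" "C \<subseteq> H" "H \<subseteq> U"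
    "\<And>f ds. f \<in> Ops \<Longrightarrow> set ds \<subseteq> H \<Longrightarrow> f ds \<in> H"
proof -
  \<comment> \<open>The operations themselves are taken as function symbols, each denoting itself,
    and the variables enumerate \<open>C\<close>. Terms over \<open>Ops\<close> then name all
    iterated applications of the operations to elements of \<open>C\<close>.\<close>
  define M :: "('d list \<Rightarrow> 'd, unit, 'd) interp" where
    "M = \<lparr>universe = U, fun_int = (\<lambda>f. f), rel_int = (\<lambda>_ _. True), prop_int = (\<lambda>_. True)\<rparr>"
  define val where "val = trm_val M (from_nat_into C)"
  define H where "H = val ` {t. set_trm t \<subseteq> Ops}"
  have "val t \<in> U" if "set_trm t \<subseteq> Ops" for t
    using that
  proof (induction t)
    case (Var n)
    then show ?case using assms(3) from_nat_into[OF assms(4)] by (auto simp: val_def)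
  next
    case (Fn f ts)
    have "f (map val ts) \<in> U"
      by (rule op) (use Fn in fastforce)+
    then show ?case by (simp add: val_def M_def)
  qed
  then have "H \<subseteq> U" by (auto simp: H_def)
  have "countable H" unfolding H_def using countable_trms[OF assms(1)] by blast
  moreover have "C \<subseteq> H"
  proof
    fix c assume "c \<in> C"
    then obtain n where "c = val (Var n)"
      using from_nat_into_surj[OF assms(2)] by (auto simp: val_def)
    then show "c \<in> H" by (auto simp: H_def)
  qed
  moreover note \<open>H \<subseteq> U\<close>
  moreover have "f ds \<in> H" if f: "f \<in> Ops" and ds: "set ds \<subseteq> H" for f ds
  proof -
    \<comment> \<open>Each argument is replaced by a term naming it, so that \<open>Fn f ts\<close>
      names \<open>f ds\<close>.\<close>
    define ts where "ts = map (inv_into {t. set_trm t \<subseteq> Ops} val) ds"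
    have "val (inv_into {t. set_trm t \<subseteq> Ops} val d) = d" if "d \<in> set ds" for d
      by (rule f_inv_into_f) (use ds that H_def in blast)
    then have "map val ts = ds" unfolding ts_def map_map by (intro map_idI) simp
    then have "val (Fn f ts) = f ds" by (simp add: val_def M_def)
    moreover have "set_trm (Fn f ts) \<subseteq> Ops"
    proof -
      have "inv_into {t. set_trm t \<subseteq> Ops} val d \<in> {t. set_trm t \<subseteq> Ops}" if "d \<in> set ds" for d
        by (rule inv_into_into) (use ds that H_def in blast)
      then show ?thesis using f by (auto simp: ts_def)
    qed
    ultimately show ?thesis unfolding H_def by (metis (mono_tags) image_eqI mem_Collect_eq)
  qed
  ultimately show ?thesis by (rule that)
qed

section \<open>Elementary substructures\<close>

lemma finite_trm_vars: "finite (trm_vars t)"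
  by (induction t) auto

lemma finite_free_vars: "finite (free_vars F)"
proof (induction F)
  case (Atom a)
  then show ?case by (cases a) (auto simp: finite_trm_vars)
qed auto

text \<open>The Tarski-Vaught test. Atoms are evaluated by the same functions and relations in both
  structures, so only quantifiers could tell them apart. As \<open>Forall\<close> is the primitive
  quantifier, the witnesses are counterexamples.\<close>

lemma tarski_vaught:
  assumes "H \<subseteq> universe M"
    and wit: "\<And>F x v. \<forall>a\<in>atoms F. atom_over Sig a \<Longrightarrow> range v \<subseteq> H \<Longrightarrow>
      \<exists>d\<in>universe M. \<not> fm_holds M (v(x := d)) F \<Longrightarrow> \<exists>d\<in>H. \<not> fm_holds M (v(x := d)) F"
  shows "range v \<subseteq> H \<Longrightarrow> \<forall>a\<in>atoms F. atom_over Sig a \<Longrightarrow>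
    fm_holds (M\<lparr>universe := H\<rparr>) v F \<longleftrightarrow> fm_holds M v F"
proof (induction F arbitrary: v)
  case (Atom a)
  have t: "trm_val (M\<lparr>universe := H\<rparr>) v t = trm_val M v t" for t
  proof (induction t)
    case (Fn f ts)
    then have "map (trm_val (M\<lparr>universe := H\<rparr>) v) ts = map (trm_val M v) ts" by simp
    then show ?case by (simp del: map_eq_conv)
  qed simp
  then have "trm_val (M\<lparr>universe := H\<rparr>) v = trm_val M v" by auto
  then show ?case by (cases a) simp_all
next
  case (Forall x F)
  have "range (v(x := d)) \<subseteq> H" if "d \<in> H" for d
    using Forall.prems(1) that by auto
  then have "fm_holds (M\<lparr>universe := H\<rparr>) (v(x := d)) F \<longleftrightarrow> fm_holds M (v(x := d)) F"
    if "d \<in> H" for d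
    using Forall that by auto
  moreover have "(\<forall>d\<in>H. fm_holds M (v(x := d)) F) \<longleftrightarrow> (\<forall>d\<in>universe M. fm_holds M (v(x := d)) F)"
    using wit[of F v x] Forall.prems assms(1) by auto
  ultimately show ?case by simp
qed auto

text \<open>\<open>C\<close> is closed under the functions of \<open>Sig\<close> and under Skolem
  functions for the countably many formulas over \<open>Sig\<close>. The closure is countable and
  passes the Tarski-Vaught test.\<close>

lemma lowenheim_skolem:
  fixes M :: "('f, 'p, 'd) interp"
  assumes Sig: "countable_sig Sig" and S: "is_structure Sig M"
    and C: "countable C" "C \<subseteq> universe M"
  obtains H where "countable H" "C \<subseteq> H" "H \<subseteq> universe M" "is_structure Sig (M\<lparr>universe := H\<rparr>)"
    "\<forall>v F. range v \<subseteq> H \<longrightarrow> (\<forall>a\<in>atoms F. atom_over Sig a) \<longrightarrow>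
       fm_holds (M\<lparr>universe := H\<rparr>) v F = fm_holds M v F"
proof -
  obtain a0 where a0: "a0 \<in> universe M" using S by (auto simp: is_structure_def)
  \<comment> \<open>A formula has finitely many free variables, so a finite list of parameters
    encodes all that matters of a valuation; positions beyond the list get
    \<open>a0\<close>.\<close>
  define asg where "asg ds i = (if i < length ds then ds ! i else a0)" for ds :: "'d list" and i
  \<comment> \<open>Closure operations act on lists of every length, but \<open>fun_int\<close> may leave the universe at a
    wrong arity.\<close>
  define fun_op where
    "fun_op f ds = (if fun_int M f ds \<in> universe M then fun_int M f ds else a0)" for f ds
  \<comment> \<open>A Skolem function: it chooses a counterexample to \<open>Forall x F\<close> from
    the parameters \<open>ds\<close>. The default \<open>a0\<close> keeps its values in the
    universe.\<close>
  define wit where "wit F x ds =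
    (if \<exists>d\<in>universe M. \<not> fm_holds M ((asg ds)(x := d)) F
     then SOME d. d \<in> universe M \<and> \<not> fm_holds M ((asg ds)(x := d)) F else a0)" for F x ds
  let ?Fms = "{F :: ('f, 'p) atom fm. \<forall>a\<in>atoms F. atom_over Sig a}"
  define Ops where "Ops = fun_op ` fst ` fst Sig \<union> (\<lambda>(F, x). wit F x) ` (?Fms \<times> UNIV)"
  have wit: "wit F x ds \<in> universe M \<and> \<not> fm_holds M ((asg ds)(x := wit F x ds)) F"
    if "\<exists>d\<in>universe M. \<not> fm_holds M ((asg ds)(x := d)) F" for F x ds
  proof -
    have "\<exists>d. d \<in> universe M \<and> \<not> fm_holds M ((asg ds)(x := d)) F" using that by blast
    from someI_ex[OF this] show ?thesis using that by (simp add: wit_def)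
  qed
  have witU: "wit F x ds \<in> universe M" for F x ds
    using wit[of ds x F] a0
    by (cases "\<exists>d\<in>universe M. \<not> fm_holds M ((asg ds)(x := d)) F") (auto simp: wit_def)
  have "countable Ops"
    unfolding Ops_def using Sig countable_fms_over[OF Sig]
    by (intro countable_Un countable_image countable_SIGMA) (auto simp: countable_sig_def)
  \<comment> \<open>Adding \<open>a0\<close> makes the generating set, and hence the universe of the
    substructure, nonempty even if \<open>C\<close> is empty.\<close>
  moreover have "countable (insert a0 C)" "insert a0 C \<subseteq> universe M" "insert a0 C \<noteq> {}"
    using C a0 by auto
  moreover have "f ds \<in> universe M" if "f \<in> Ops" for f ds
    using that a0 witU by (auto simp: Ops_def fun_op_def)
  ultimately obtain H where H: "countable H" "insert a0 C \<subseteq> H" "H \<subseteq> universe M"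
    and closed: "\<And>f ds. f \<in> Ops \<Longrightarrow> set ds \<subseteq> H \<Longrightarrow> f ds \<in> H"
    using countable_closure[of Ops "insert a0 C" "universe M"] by metis
  have "fun_int M f ds \<in> H" if "(f, length ds) \<in> fst Sig" "set ds \<subseteq> H" for f ds
  proof -
    have "fun_int M f ds \<in> universe M" using is_structureD[OF S that(1)] that(2) H(3) by auto
    moreover have "fun_op f \<in> Ops" using that(1) by (force simp: Ops_def)
    ultimately show ?thesis using closed[OF _ that(2), of "fun_op f"] by (simp add: fun_op_def)
  qed
  then have SH: "is_structure Sig (M\<lparr>universe := H\<rparr>)"
    using H(2) by (auto simp: is_structure_def)
  have witness: "\<exists>d\<in>H. \<not> fm_holds M (v(x := d)) F"
    if F: "\<forall>a\<in>atoms F. atom_over Sig a" and v: "range v \<subseteq> H"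
      and ex: "\<exists>d\<in>universe M. \<not> fm_holds M (v(x := d)) F" for F x v
  proof -
    \<comment> \<open>With \<open>n\<close> above all free variables of \<open>F\<close>, the table
      \<open>ds\<close> of the first \<open>n\<close> values of \<open>v\<close> determines the
      truth of \<open>F\<close>, so the Skolem function applied to \<open>ds\<close> supplies the
      witness for \<open>v\<close>.\<close>
    obtain n where n: "\<forall>y\<in>free_vars F. y < n"
      using finite_free_vars[of F] by (auto simp: finite_nat_set_iff_bounded)
    define ds where "ds = map v [0..<n]"
    have eq: "fm_holds M (v(x := d)) F = fm_holds M ((asg ds)(x := d)) F" for d
      by (rule fm_holds_cong) (use n in \<open>auto simp: asg_def ds_def\<close>)
    have "wit F x \<in> Ops" using F by (force simp: Ops_def)
    then have "wit F x ds \<in> H" by (rule closed) (use v in \<open>auto simp: ds_def\<close>)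
    moreover have "\<not> fm_holds M (v(x := wit F x ds)) F" using wit[of ds x F] ex eq by simp
    ultimately show ?thesis by blast
  qed
  show ?thesis
    by (rule that[of H]) (use H SH tarski_vaught[OF H(3) witness] in auto)
qed


section \<open>Amalgamation\<close>

lemma extend_to_bijection:
  assumes A: "finite A" "A \<subseteq> X" and g: "inj_on g A" "g ` A \<subseteq> Y"
    and X: "countable X" "infinite X" and Y: "countable Y" "infinite Y"
  obtains h where "bij_betw h X Y" "\<And>a. a \<in> A \<Longrightarrow> h a = g a"
proof -
  obtain e where e: "bij_betw e (X - A) (UNIV :: nat set)"
    using countableE_infinite[of "X - A"] X A(1) by (metis countable_Diff Diff_infinite_finite)
  obtain e' where e': "bij_betw e' (Y - g ` A) (UNIV :: nat set)"
    using countableE_infinite[of "Y - g ` A"] Y A(1)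
    by (metis countable_Diff Diff_infinite_finite finite_imageI)
  define k where "k = inv_into (Y - g ` A) e' \<circ> e"
  have k: "bij_betw k (X - A) (Y - g ` A)"
    unfolding k_def using bij_betw_trans[OF e bij_betw_inv_into[OF e']] .
  have "bij_betw (\<lambda>x. if x \<in> A then g x else k x) (A \<union> (X - A)) (g ` A \<union> (Y - g ` A))"
    using bij_betw_disjoint_Un[OF inj_on_imp_bij_betw[OF g(1)] k] by auto
  moreover have "A \<union> (X - A) = X" "g ` A \<union> (Y - g ` A) = Y" using A g by auto
  ultimately have "bij_betw (\<lambda>x. if x \<in> A then g x else k x) X Y" by simp
  then show ?thesis by (rule that) simp
qed

section \<open>Conjunctions of literals and ed-extensions\<close>

lemma conj_holds_Un: "conj_holds M v (\<psi> \<union> \<chi>) \<longleftrightarrow> conj_holds M v \<psi> \<and> conj_holds M v \<chi>"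
  by (auto simp: conj_holds_def)

text \<open>Bridges two representations: \<open>stably_infinite\<close> speaks of quantifier-free
  formulas, whereas assignments are sets of literals.\<close>

lemma conj_as_formula:
  assumes "finite \<psi>" "\<forall>l\<in>\<psi>. pure Sig l"
  obtains F where "quantifier_free F" "\<forall>a\<in>atoms F. atom_over Sig a"
    "\<forall>(M :: ('f, 'p, 'd) interp) v. fm_holds M v F \<longleftrightarrow> conj_holds M v \<psi>"
proof -
  have "\<exists>F. quantifier_free F \<and> (\<forall>a\<in>atoms F. atom_over Sig a) \<and>
    (\<forall>(M :: ('f, 'p, 'd) interp) v. fm_holds M v F \<longleftrightarrow> conj_holds M v \<psi>)"
    using assms
  proof (induction \<psi>)
    case empty
    show ?case
      \<comment> \<open>The empty conjunction needs a valid formula over an arbitrary signature; an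
        equality between variables uses no symbol of it.\<close>
      by (rule exI[of _ "Atom (Equal (Var 0) (Var 0))"]) (simp add: conj_holds_def)
  next
    case (insert l \<psi>)
    then obtain F where F: "quantifier_free F" "\<forall>a\<in>atoms F. atom_over Sig a"
      "\<forall>(M :: ('f, 'p, 'd) interp) v. fm_holds M v F \<longleftrightarrow> conj_holds M v \<psi>" by auto
    define L where "L = (case l of Pos a \<Rightarrow> Atom a | Not a \<Rightarrow> Neg (Atom a))"
    have "quantifier_free L" "\<forall>a\<in>atoms L. atom_over Sig a"
      "\<forall>(M :: ('f, 'p, 'd) interp) v. fm_holds M v L \<longleftrightarrow> lit_holds M v l"
      using insert.prems by (cases l; simp add: L_def pure_def)+
    with F show ?case
      by (intro exI[of _ "Conj L F"]) (auto simp: conj_holds_def)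
  qed
  then show ?thesis using that by blast
qed

text \<open>The literals mention only pairs ordered by \<open>prec\<close>. Totality of
  \<open>prec\<close>, together with reflexivity and symmetry of both \<open>R\<close> and equality
  of values, settles the remaining pairs. Hence two models of the same \<open>mu_ed\<close> identify
  the same interface variables, even if their domains differ.\<close>

lemma conj_holds_mu_ed:
  fixes M :: "('a, 'b, 'd) interp"
  assumes R: "equiv V R" and prec: "strict_linear_order_on V prec"
  shows "conj_holds M v (mu_ed V prec R) \<longleftrightarrow> (\<forall>x\<in>V. \<forall>y\<in>V. v x = v y \<longleftrightarrow> (x, y) \<in> R)"
    (is "?L \<longleftrightarrow> ?R")
proof -
  have "?L \<longleftrightarrow> (\<forall>x\<in>V. \<forall>y\<in>V. (x, y) \<in> prec \<longrightarrow> (v x = v y \<longleftrightarrow> (x, y) \<in> R))"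
  proof -
    have *: "(\<forall>l\<in>{f x y |x y. P x y}. Q l) \<longleftrightarrow> (\<forall>x y. P x y \<longrightarrow> Q (f x y))"
      for f :: "nat \<Rightarrow> nat \<Rightarrow> ('a, 'b) atom literal" and P Q by blast
    have "conj_holds M v (mu_e V prec R) \<longleftrightarrow>
        (\<forall>x y. (x, y) \<in> interface_equalities V prec \<and> (x, y) \<in> R \<longrightarrow> v x = v y)"
      unfolding conj_holds_def mu_e_def by (subst *) simp
    moreover have "conj_holds M v (mu_d V prec R) \<longleftrightarrow>
        (\<forall>x y. (x, y) \<in> interface_equalities V prec \<and> (x, y) \<notin> R \<longrightarrow> v x \<noteq> v y)"
      unfolding conj_holds_def mu_d_def by (subst *) simp
    ultimately show ?thesis
      unfolding mu_ed_def conj_holds_Un interface_equalities_def by blast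
  qed
  moreover have "v x = v y \<longleftrightarrow> (x, y) \<in> R"
    if *: "\<forall>x\<in>V. \<forall>y\<in>V. (x, y) \<in> prec \<longrightarrow> (v x = v y \<longleftrightarrow> (x, y) \<in> R)"
      and x: "x \<in> V" and y: "y \<in> V" for x y
  proof -
    have "x = y \<or> (x, y) \<in> prec \<or> (y, x) \<in> prec"
      using prec x y by (auto simp: strict_linear_order_on_def total_on_def)
    moreover have "(x, x) \<in> R" using R x by (simp add: equiv_def refl_on_def)
    moreover have "(x, y) \<in> R \<longleftrightarrow> (y, x) \<in> R" using R by (auto simp: equiv_def sym_def)
    ultimately show ?thesis using * x y by metis
  qed
  ultimately show ?thesis by blast
qed

lemma pure_mu_ed: "l \<in> mu_ed V prec R \<Longrightarrow> pure Sig l"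
  by (auto simp: mu_ed_def mu_e_def mu_d_def pure_def)

lemma finite_mu_ed:
  assumes "finite V"
  shows "finite (mu_ed V prec R)"
proof -
  have "mu_ed V prec R \<subseteq> (\<lambda>(x, y). Pos (Equal (Var x) (Var y))) ` (V \<times> V)
      \<union> (\<lambda>(x, y). Not (Equal (Var x) (Var y))) ` (V \<times> V)"
    by (auto simp: mu_ed_def mu_e_def mu_d_def interface_equalities_def)
  then show ?thesis by (rule finite_subset) (use assms in auto)
qed

lemma finite_pure_vars:
  assumes "finite \<mu>"
  shows "finite (pure_vars Sig \<mu>)"
proof -
  have "finite (atom_vars a)" for a :: "('f, 'p) atom"
    by (cases a) (auto simp: finite_trm_vars)
  then show ?thesis using assms by (auto simp: pure_vars_def)
qed

lemma finite_truth_assignment: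
  assumes "truth_assignment F \<mu>"
  shows "finite \<mu>"
proof -
  have "finite (atoms F)" by (induction F) auto
  moreover have "\<mu> \<subseteq> Pos ` atoms F \<union> Not ` atoms F"
  proof
    fix l assume "l \<in> \<mu>"
    then have "atom_of l \<in> atoms F" using assms by (auto simp: truth_assignment_def)
    then show "l \<in> Pos ` atoms F \<union> Not ` atoms F" by (cases l) auto
  qed
  ultimately show ?thesis by (meson finite_UnI finite_imageI finite_subset)
qed

text \<open>Loewenheim-Skolem is applied to the range of \<open>v\<close>, so that \<open>v\<close>
  remains an assignment, together with a countably infinite set \<open>D\<close>, so that the
  substructure remains infinite. Its universe is then in bijection with the rationals, with values
  on \<open>A\<close> prescribed.\<close>

lemma infinite_rational_model:
  fixes M :: "('f, 'p, 'u) interp" and g :: "'u \<Rightarrow> rat"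
  assumes Sig: "countable_sig Sig" and T: "\<forall>F\<in>T. sentence_over Sig F"
    and M: "M \<in> theory_models Sig T" "infinite (universe M)" and v: "assignment M v"
    and A: "finite A" "A \<subseteq> range v" and g: "inj_on g A"
  obtains H and h where "M\<lparr>universe := H\<rparr> \<in> theory_models Sig T" "range v \<subseteq> H"
    "bij_betw h H UNIV" "\<And>a. a \<in> A \<Longrightarrow> h a = g a"
proof -
  obtain D where D: "D \<subseteq> universe M" "infinite D" "countable D"
    using infinite_countable_subset'[OF M(2)] by blast
  have S: "is_structure Sig M" using M by (simp add: theory_models_def)
  have C: "countable (range v \<union> D)" "range v \<union> D \<subseteq> universe M"
    using D v by (auto simp: assignment_def)
  obtain H where H: "countable H" "range v \<union> D \<subseteq> H" "H \<subseteq> universe M"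
    "is_structure Sig (M\<lparr>universe := H\<rparr>)"
    and elem: "\<forall>v F. range v \<subseteq> H \<longrightarrow> (\<forall>a\<in>atoms F. atom_over Sig a) \<longrightarrow>
       fm_holds (M\<lparr>universe := H\<rparr>) v F = fm_holds M v F"
    by (rule lowenheim_skolem[OF Sig S C])
  have "fm_holds (M\<lparr>universe := H\<rparr>) w F" if "F \<in> T" "range w \<subseteq> H" for F w
  proof -
    have "\<forall>a\<in>atoms F. atom_over Sig a" using T that(1) by (simp add: sentence_over_def)
    moreover have "fm_holds M w F"
      using M(1) that H(3) by (auto simp: theory_models_def assignment_def)
    ultimately show ?thesis using elem that(2) by blast
  qed
  then have "M\<lparr>universe := H\<rparr> \<in> theory_models Sig T"
    using H(4) by (simp add: theory_models_def assignment_def)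
  moreover have "range v \<subseteq> H" using H(2) by simp
  moreover have "infinite H" using D H(2) by (meson Un_subset_iff finite_subset)
  obtain h where "bij_betw h H (UNIV :: rat set)" "\<And>a. a \<in> A \<Longrightarrow> h a = g a"
  proof (rule extend_to_bijection[OF A(1) _ g _ H(1) \<open>infinite H\<close>])
    show "A \<subseteq> H" using A(2) H(2) by blast
    show "infinite (UNIV :: rat set)" by (rule infinite_UNIV_char_0)
  qed auto
  ultimately show ?thesis by (rule that)
qed

text \<open>\<open>P\<close> and \<open>Q\<close> stand for the variables of the arithmetic and of
  the \<open>Sig\<close> part. The clause on \<open>u x = w x\<close> also covers variables in
  neither part, as the cost variable need not occur in the assignment.\<close>

lemma combine_models:
  fixes M :: "('f fun_sym, 'p pred_sym, 'u) interp"
    and N :: "('f fun_sym, 'p pred_sym, rat) interp"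
  assumes Sig: "countable_sig Sig" "disjoint_sigs Sig LA_sig" and T: "\<forall>F\<in>T. sentence_over Sig F"
    and M: "M \<in> theory_models Sig T" "infinite (universe M)" "assignment M v"
    and N: "N \<in> LA_models"
    and fin: "finite (P \<inter> Q)"
    and eq: "\<And>x y. x \<in> P \<inter> Q \<Longrightarrow> y \<in> P \<inter> Q \<Longrightarrow> v x = v y \<longleftrightarrow> w x = w y"
  obtains K u where "K \<in> combined_models Sig T"
    "prop_int K = prop_int N"
    "\<forall>x. x \<notin> Q - P \<longrightarrow> u x = w x"
    "\<forall>l. pure Sig l \<longrightarrow> atom_vars (atom_of l) \<subseteq> Q \<longrightarrow> lit_holds K u l = lit_holds M v l"
    "\<forall>l. pure LA_sig l \<longrightarrow> atom_vars (atom_of l) \<subseteq> P \<longrightarrow> lit_holds K u l = lit_holds N w l"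
proof -
  define V where "V = P \<inter> Q"
  \<comment> \<open>\<open>g\<close> sends the value of a shared variable in \<open>M\<close> to its
    value in \<open>N\<close>. By \<open>eq\<close>, the choice made by \<open>inv_into\<close> is
    immaterial and \<open>g\<close> is injective.\<close>
  define g where "g = w \<circ> inv_into V v"
  have gv: "g (v x) = w x" if "x \<in> V" for x
  proof -
    have "v (inv_into V v (v x)) = v x" "inv_into V v (v x) \<in> V"
      using that by (auto intro: f_inv_into_f inv_into_into)
    then show ?thesis using eq that by (simp add: g_def V_def)
  qed
  have g: "inj_on g (v ` V)"
    using eq by (auto simp: inj_on_def gv) (auto simp: V_def)
  obtain H h where H: "M\<lparr>universe := H\<rparr> \<in> theory_models Sig T" "range v \<subseteq> H"
    "bij_betw h H UNIV" "\<And>a. a \<in> v ` V \<Longrightarrow> h a = g a"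
  proof (rule infinite_rational_model[OF Sig(1) T M])
    show "finite (v ` V)" using fin by (simp add: V_def)
  qed (use g in auto)
  define M' where "M' = M\<lparr>universe := H\<rparr>"
  define K where "K = overlay Sig h M' N"
  \<comment> \<open>On shared variables the two cases agree, because
    \<open>h (v x) = g (v x) = w x\<close>.\<close>
  define u where "u x = (if x \<in> Q then h (v x) else w x)" for x
  have S: "is_structure Sig M'" and v: "assignment M' v"
    using H by (auto simp: theory_models_def assignment_def M'_def)
  have iso: "isomorphism Sig h M' K"
    unfolding K_def by (rule isomorphism_overlay) (use H(3) in \<open>simp add: M'_def bij_betw_def\<close>)
  have LA: "K \<in> LA_models" "isomorphism LA_sig id N K"
    using overlay_LA_models[OF Sig(2) N, of h M'] H(3) by (auto simp: K_def M'_def bij_betw_def)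
  have "K \<in> combined_models Sig T"
    using isomorphism_theory_models[OF T _ iso] H(1) LA by (simp add: M'_def combined_models_def)
  moreover have "prop_int K = prop_int N" by (simp add: K_def overlay_def)
  moreover have uw: "u x = w x" if "x \<notin> Q - P" for x
    using that gv[of x] H(4)[of "v x"] by (auto simp: u_def V_def)
  moreover have "lit_holds K u l \<longleftrightarrow> lit_holds M v l"
    if "pure Sig l" "atom_vars (atom_of l) \<subseteq> Q" for l
  proof -
    \<comment> \<open>Literals have no quantifiers, so shrinking the universe to \<open>H\<close>
      does not affect their truth.\<close>
    have "trm_val M' v t = trm_val M v t" for t
    proof (induction t)
      case (Fn f ts)
      then have "map (trm_val M' v) ts = map (trm_val M v) ts" by simp
      then show ?case by (simp del: map_eq_conv add: M'_def)
    qed simp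
    then have "trm_val M' v = trm_val M v" by auto
    then have "atom_holds M' v a \<longleftrightarrow> atom_holds M v a" for a by (cases a) (simp_all add: M'_def)
    then have "lit_holds M' v l \<longleftrightarrow> lit_holds M v l" by (cases l) auto
    moreover have "lit_holds K u l \<longleftrightarrow> lit_holds K (h \<circ> v) l"
      by (rule lit_holds_cong) (use that in \<open>auto simp: u_def\<close>)
    ultimately show ?thesis using isomorphism_lit_holds[OF S iso v that(1)] by simp
  qed
  moreover have "lit_holds K u l \<longleftrightarrow> lit_holds N w l"
    if "pure LA_sig l" "atom_vars (atom_of l) \<subseteq> P" for l
  proof -
    have "assignment N w" using N by (simp add: assignment_def LA_models_def)
    moreover have "lit_holds K u l \<longleftrightarrow> lit_holds K w l"
      by (rule lit_holds_cong) (use that uw in auto)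
    ultimately show ?thesis
      using isomorphism_lit_holds[OF LA_models_structure[OF N] LA(2) _ that(1), of w] by simp
  qed
  ultimately show ?thesis by (intro that[of K u]) simp_all
qed

text \<open>Combined models live on the rationals, whereas satisfiability in \<open>T\<close> refers
  to the type \<open>'u\<close>. The countable set of rationals embeds into any infinite type, and
  the image of a model is again a model.\<close>

lemma satisfiable_in_infinite_type:
  fixes M :: "('f, 'p, rat) interp"
  assumes T: "\<forall>F\<in>T. sentence_over Sig F" and M: "M \<in> theory_models Sig T" "assignment M v"
    and \<psi>: "conj_holds M v \<psi>" "\<forall>l\<in>\<psi>. pure Sig l"
  shows "theory_satisfiable TYPE('u::infinite) Sig T \<psi>"
proof -
  obtain e :: "nat \<Rightarrow> 'u" where e: "inj e"
    using infinite_countable_subset[OF infinite_UNIV] by blast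
  define h where "h = e \<circ> (to_nat :: rat \<Rightarrow> nat)"
  have "inj h" unfolding h_def by (intro inj_compose e inj_to_nat)
  then have iso: "isomorphism Sig h M (overlay Sig h M N)" for N
    by (intro isomorphism_overlay) (auto intro: inj_on_subset)
  \<comment> \<open>Here \<open>undefined\<close> only fills in what lies outside
    \<open>Sig\<close>, which neither \<open>T\<close> nor the literals mention.\<close>
  let ?N = "overlay Sig h M undefined"
  have S: "is_structure Sig M" using M by (simp add: theory_models_def)
  have "?N \<in> theory_models Sig T" using isomorphism_theory_models[OF T M(1) iso] .
  moreover have "assignment ?N (h \<circ> v)"
    using M(2) by (auto simp: assignment_def overlay_def)
  moreover have "conj_holds ?N (h \<circ> v) \<psi>"
    using \<psi> isomorphism_lit_holds[OF S iso M(2)] by (simp add: conj_holds_def)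
  ultimately show ?thesis unfolding theory_satisfiable_def satisfiable_in_def by blast
qed

section \<open>Minimal cost over the ed-extensions\<close>

theorem theorem3p4:
  fixes Sig :: "('f fun_sym, 'p pred_sym) signature"
    and T :: "('f fun_sym, 'p pred_sym) atom fm set"
    and \<phi> :: "('f fun_sym, 'p pred_sym) atom fm"
    and \<mu> \<mu>B \<mu>LA \<mu>T :: "('f fun_sym, 'p pred_sym) atom literal set"
    and prec :: "(nat \<times> nat) set"
    and cost :: nat
  assumes "countable_sig Sig"
    and "disjoint_sigs Sig LA_sig"
    and "\<forall>F\<in>T. sentence_over Sig F"
    and "stably_infinite TYPE('u::infinite) Sig T"
    and "combined_ground_formula Sig \<phi>"
    and "truth_assignment \<phi> \<mu>"
    and "prop_satisfies \<mu> \<phi>"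
    and "\<mu> = \<mu>B \<union> \<mu>LA \<union> \<mu>T"
    and "\<forall>l\<in>\<mu>B. boolean_literal l" and "consistent \<mu>B"
    and "\<forall>l\<in>\<mu>LA. pure LA_sig l"
    and "\<forall>l\<in>\<mu>T. pure Sig l"
    and "LA_variable Sig \<mu> cost"
    and "strict_linear_order_on (interface_vars Sig \<mu>) prec"
  shows "mincost (combined_models Sig T) cost \<mu> =
           Min (mincost (combined_models Sig T) cost ` EX_ed Sig prec \<mu>) \<and>
         (\<forall>R \<eta> \<mu>ed. equiv (interface_vars Sig \<mu>) R \<longrightarrow>
            \<mu>ed = mu_ed (interface_vars Sig \<mu>) prec R \<longrightarrow> \<eta> = \<mu> \<union> \<mu>ed \<longrightarrow>
            mincost (combined_models Sig T) cost \<eta> =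
              (if \<not> theory_satisfiable TYPE('u) Sig T (\<mu>T \<union> \<mu>ed)
                  \<or> \<not> satisfiable_in (LA_models :: ('f fun_sym, 'p pred_sym, rat) interp set) (\<mu>LA \<union> \<mu>ed)
               then \<infinity>
               else mincost LA_models cost (\<mu>LA \<union> \<mu>ed)))"
  proof -
  define V where "V = interface_vars Sig \<mu>"
  define C where "C = combined_models Sig T"
  define P where "P = pure_vars LA_sig \<mu>"
  define Q where "Q = pure_vars Sig \<mu>"
  note T = assms(3) and \<mu> = assms(8)
  have prec: "strict_linear_order_on V prec" using assms(14) by (simp add: V_def)
  have fin: "finite \<mu>" using finite_truth_assignment[OF assms(6)] .
  have VPQ: "V = P \<inter> Q" by (simp add: V_def P_def Q_def interface_vars_def)
  have finV: "finite V" unfolding VPQ P_def using finite_pure_vars[OF fin] by blast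
  have varsLA: "atom_vars (atom_of l) \<subseteq> P" if "l \<in> \<mu>LA" for l
    using that assms(11) \<mu> by (auto simp: P_def pure_vars_def)
  have varsT: "atom_vars (atom_of l) \<subseteq> Q" if "l \<in> \<mu>T" for l
    using that assms(12) \<mu> by (auto simp: Q_def pure_vars_def)
  have vars_ed: "atom_vars (atom_of l) \<subseteq> V" if "l \<in> mu_ed V prec R"
    for l :: "('f fun_sym, 'p pred_sym) atom literal" and R
    using that by (auto simp: mu_ed_def mu_e_def mu_d_def interface_equalities_def)
  have asg: "assignment M v" if "M \<in> LA_models"
    for M :: "('f fun_sym, 'p pred_sym, rat) interp" and v
    using that by (simp add: LA_models_def assignment_def)

  \<comment> \<open>The hard direction of (b): an arithmetic model and satisfiability of the other
    part yield a model of the whole extension at the same cost.\<close>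
  have amalgam: "\<exists>K u. K \<in> C \<and> assignment K u \<and> conj_holds K u (\<mu> \<union> mu_ed V prec R) \<and> u cost = w cost"
    if R: "equiv V R" and sat: "theory_satisfiable TYPE('u) Sig T (\<mu>T \<union> mu_ed V prec R)"
      and N: "N \<in> LA_models" and w: "conj_holds N w (\<mu>LA \<union> mu_ed V prec R)" for R N w
  proof -
    have "finite (\<mu>T \<union> mu_ed V prec R)" using fin \<mu> finite_mu_ed[OF finV] by simp
    moreover have "\<forall>l\<in>\<mu>T \<union> mu_ed V prec R. pure Sig l" using assms(12) pure_mu_ed by blast
    ultimately obtain F where F: "quantifier_free F" "\<forall>a\<in>atoms F. atom_over Sig a"
      "\<forall>(M :: ('f fun_sym, 'p pred_sym, 'u) interp) v.
         fm_holds M v F \<longleftrightarrow> conj_holds M v (\<mu>T \<union> mu_ed V prec R)"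
      by (rule conj_as_formula[where 'd = 'u])
    obtain M :: "('f fun_sym, 'p pred_sym, 'u) interp" and v
      where M: "M \<in> theory_models Sig T" "infinite (universe M)" "assignment M v"
        and v: "conj_holds M v (\<mu>T \<union> mu_ed V prec R)"
      using assms(4) sat F unfolding stably_infinite_def theory_satisfiable_def satisfiable_in_def
      by metis
    \<comment> \<open>No pure literal contains a Boolean atom, so these atoms may be set freely.
      Reading them off \<open>\<mu>B\<close> satisfies its negative literals as well, by
      consistency.\<close>
    define N' where "N' = N\<lparr>prop_int := (\<lambda>b. Pos (Prop b) \<in> \<mu>B)\<rparr>"
    have N': "N' \<in> LA_models" using N by (simp add: N'_def LA_models_def)
    have "isomorphism LA_sig id N N'" by (simp add: isomorphism_def N'_def)
    then have NN': "lit_holds N' w l \<longleftrightarrow> lit_holds N w l" if "pure LA_sig l" for l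
      using isomorphism_lit_holds[OF LA_models_structure[OF N] _ asg[OF N] that, of id N' w]
      by simp
    have vw: "v x = v y \<longleftrightarrow> w x = w y" if "x \<in> P \<inter> Q" "y \<in> P \<inter> Q" for x y
      \<comment> \<open>Both valuations induce the same relation \<open>R\<close> on the interface
        variables.\<close>
      using v w that unfolding conj_holds_Un conj_holds_mu_ed[OF R prec] VPQ[symmetric] by blast
    obtain K u where K: "K \<in> combined_models Sig T" "prop_int K = prop_int N'"
      and u: "\<forall>x. x \<notin> Q - P \<longrightarrow> u x = w x"
      and litT: "\<forall>l. pure Sig l \<longrightarrow> atom_vars (atom_of l) \<subseteq> Q \<longrightarrow> lit_holds K u l = lit_holds M v l"
      and litLA: "\<forall>l. pure LA_sig l \<longrightarrow> atom_vars (atom_of l) \<subseteq> P \<longrightarrow>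
        lit_holds K u l = lit_holds N' w l"
      by (rule combine_models[OF assms(1,2) T M N' finV[unfolded VPQ] vw])
    have "conj_holds K u \<mu>B"
    proof -
      have "lit_holds K u l" if l: "l \<in> \<mu>B" for l
      proof -
        obtain b where "atom_of l = Prop b" using assms(9) l by (auto simp: boolean_literal_def)
        then show ?thesis
          using l assms(10) K(2) by (cases l) (auto simp: N'_def consistent_def)
      qed
      then show ?thesis by (simp add: conj_holds_def)
    qed
    moreover have "conj_holds K u \<mu>T"
      using v assms(12) litT varsT by (simp add: conj_holds_def)
    moreover have "conj_holds K u (\<mu>LA \<union> mu_ed V prec R)"
    proof -
      have "lit_holds K u l" if l: "l \<in> \<mu>LA \<union> mu_ed V prec R" for l
      proof -
        have "pure LA_sig l" using l assms(11) pure_mu_ed by blast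
        moreover have "atom_vars (atom_of l) \<subseteq> P" using l varsLA vars_ed VPQ by blast
        ultimately show ?thesis using litLA NN' w l by (simp add: conj_holds_def)
      qed
      then show ?thesis by (simp add: conj_holds_def)
    qed
    moreover have "u cost = w cost"
      using u assms(13) by (auto simp: LA_variable_def P_def Q_def)
    moreover have "assignment K u" using K(1) asg by (auto simp: combined_models_def)
    ultimately show ?thesis using K(1) unfolding C_def \<mu> conj_holds_Un by blast
  qed

  \<comment> \<open>The easy direction of (b): a combined model already contains an arithmetic
    model, and its part over \<open>Sig\<close> is moved to the type \<open>'u\<close>.\<close>
  have split: "M \<in> LA_models \<and> conj_holds M v (\<mu>LA \<union> mu_ed V prec R) \<and>
      theory_satisfiable TYPE('u) Sig T (\<mu>T \<union> mu_ed V prec R)"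
    if M: "M \<in> C" "assignment M v" and v: "conj_holds M v (\<mu> \<union> mu_ed V prec R)" for M v R
  proof -
    have "\<forall>l\<in>\<mu>T \<union> mu_ed V prec R. pure Sig l" using assms(12) pure_mu_ed by blast
    then have "theory_satisfiable TYPE('u) Sig T (\<mu>T \<union> mu_ed V prec R)"
      using satisfiable_in_infinite_type[OF T _ M(2), of "\<mu>T \<union> mu_ed V prec R"] M(1) v
      by (simp add: C_def combined_models_def \<mu> conj_holds_Un)
    then show ?thesis using M(1) v by (simp add: C_def combined_models_def \<mu> conj_holds_Un)
  qed

  have b: "mincost C cost (\<mu> \<union> mu_ed V prec R) =
      (if \<not> theory_satisfiable TYPE('u) Sig T (\<mu>T \<union> mu_ed V prec R)
          \<or> \<not> satisfiable_in (LA_models :: ('f fun_sym, 'p pred_sym, rat) interp set)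
                (\<mu>LA \<union> mu_ed V prec R)
       then \<infinity>
       else mincost LA_models cost (\<mu>LA \<union> mu_ed V prec R))"
    (is "_ = (if ?unsat then _ else _)") if R: "equiv V R" for R
  proof (cases ?unsat)
    \<comment> \<open>By \<open>split\<close> the extension has no model, so the infimum is over the
      empty set.\<close>
    case True
    then have "{ereal (real_of_rat (v cost)) |M v.
        M \<in> C \<and> assignment M v \<and> conj_holds M v (\<mu> \<union> mu_ed V prec R)} = {}"
      using split by (fastforce simp: satisfiable_in_def)
    then have "mincost C cost (\<mu> \<union> mu_ed V prec R) = \<infinity>"
      unfolding mincost_def by (simp only: Inf_empty top_ereal_def)
    with True show ?thesis by (simp only: if_True)
  next
    case False
    \<comment> \<open>Not only the infima but the sets of attainable costs coincide:
      \<open>split\<close> gives one inclusion and \<open>amalgam\<close> the other.\<close>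
    have "{ereal (real_of_rat (v cost)) |M v.
        M \<in> C \<and> assignment M v \<and> conj_holds M v (\<mu> \<union> mu_ed V prec R)} =
      {ereal (real_of_rat (v cost)) |(M :: ('f fun_sym, 'p pred_sym, rat) interp) v.
        M \<in> LA_models \<and> assignment M v \<and> conj_holds M v (\<mu>LA \<union> mu_ed V prec R)}"
      (is "?X = ?Y")
    proof
      show "?X \<subseteq> ?Y" using split by blast
      show "?Y \<subseteq> ?X"
      proof
        fix c assume "c \<in> ?Y"
        then obtain M :: "('f fun_sym, 'p pred_sym, rat) interp" and v
          where M: "M \<in> LA_models" "conj_holds M v (\<mu>LA \<union> mu_ed V prec R)"
            and c: "c = ereal (real_of_rat (v cost))" by blast
        obtain K u where "K \<in> C" "assignment K u" "conj_holds K u (\<mu> \<union> mu_ed V prec R)"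
          "u cost = v cost"
          using amalgam[OF R _ M] False by blast
        then show "c \<in> ?X" unfolding c by (smt (verit) mem_Collect_eq)
      qed
    qed
    then show ?thesis using False unfolding mincost_def by simp
  qed

  have EX: "EX_ed Sig prec \<mu> = (\<lambda>R. \<mu> \<union> mu_ed V prec R) ` {R. equiv V R}"
    by (auto simp: EX_ed_def V_def)
  \<comment> \<open>There are finitely many equivalence relations on the finite set
    \<open>V\<close>, and the identity is one of them; the minimum in (a) is therefore over a finite
    nonempty set.\<close>
  have "{R. equiv V R} \<subseteq> Pow (V \<times> V)" by (auto simp: equiv_def refl_on_def)
  then have finR: "finite {R. equiv V R}" by (rule finite_subset) (use finV in simp)
  have "Id_on V \<in> {R. equiv V R}"
    by (auto simp: equiv_def refl_on_def sym_def trans_def)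
  then have neR: "{R. equiv V R} \<noteq> {}" by blast

  define vals where "vals \<psi> = {ereal (real_of_rat (v cost)) |M v.
    M \<in> C \<and> assignment M v \<and> conj_holds M v \<psi>}" for \<psi>
  have mc: "mincost C cost \<psi> = Inf (vals \<psi>)" for \<psi> by (simp add: mincost_def vals_def)
  have "\<exists>R. equiv V R \<and> conj_holds M v (\<mu> \<union> mu_ed V prec R)" if "conj_holds M v \<mu>"
    for M :: "('f fun_sym, 'p pred_sym, rat) interp" and v
  proof -
    \<comment> \<open>The kernel of \<open>v\<close> on \<open>V\<close> selects the extension that
      this model satisfies.\<close>
    define R where "R = {(x, y). x \<in> V \<and> y \<in> V \<and> v x = v y}"
    have R: "equiv V R" by (auto simp: R_def equiv_def refl_on_def sym_def trans_def)
    have "conj_holds M v (mu_ed V prec R)"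
      unfolding conj_holds_mu_ed[OF R prec] by (auto simp: R_def)
    with R that show ?thesis by (auto simp: conj_holds_Un)
  qed
  then have "vals \<mu> = (\<Union>\<eta>\<in>EX_ed Sig prec \<mu>. vals \<eta>)"
    unfolding vals_def EX by (auto simp: conj_holds_Un) blast+
  \<comment> \<open>The infimum of a union is the infimum of the infima of its members.\<close>
  then have "mincost C cost \<mu> = (INF \<eta>\<in>EX_ed Sig prec \<mu>. mincost C cost \<eta>)"
    unfolding mc
    by (intro antisym INF_greatest Inf_greatest)
      (auto intro: Inf_superset_mono INF_lower2 Inf_lower)
  also have "\<dots> = Min (mincost C cost ` EX_ed Sig prec \<mu>)"
    using finR neR by (intro cInf_eq_Min) (auto simp: EX)
  finally have "mincost C cost \<mu> = Min (mincost C cost ` EX_ed Sig prec \<mu>)" .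
  with b show ?thesis unfolding C_def V_def by blast
qed

end
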